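(* Let $G$ be a countably infinite discrete group and let $X$ be an aperiodic Borel $G$-space. Then there is a $G$-equivariant Borel map from $X$ to the aperiodic part of the shift action of $G$ on $2^G$, i.e. a $G$-equivariant Borel map $f:X\to 2^G$ such that for every $x\in X$ the $G$-orbit of $f(x)$ in $2^G$ is infinite.
   Context: A Borel $G$-space is a standard Borel space $X$ equipped with a Borel action of $G$; it is aperiodic if every orbit is infinite. $2^G=\{0,1\}^G$ has the product topology and the shift action $(g\cdot y)(h)=y(g^{-1}h)$ for $g,h\in G$, $y\in 2^G$. The aperiodic part of $2^G$ is the invariant set of all $y\in 2^G$ whose orbit is infinite. *)

theory Defs
  imports "HOL-Analysis.Analysis" "HOL-Algebra.Group_Action"
begin

definition Polish_space :: "'a topology \<Rightarrow> bool" where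
  "Polish_space T \<longleftrightarrow> completely_metrizable_space T \<and> second_countable T"

definition borel_of :: "'a topology \<Rightarrow> 'a measure" where
  "borel_of T = sigma (topspace T) {U. openin T U}"

text \<open>Measurable spaces are represented by the type \<^typ>\<open>'a measure\<close>, whose measure component is
  ignored throughout.\<close>

definition standard_Borel_space :: "'a measure \<Rightarrow> bool" where
  "standard_Borel_space M \<longleftrightarrow>
     (\<exists>T. Polish_space T \<and> space M = topspace T \<and> sets M = sets (borel_of T))"

text \<open>The acting group is discrete, so its Borel sets are all subsets of its carrier.\<close>

locale Borel_G_space = group_action G "space M" \<phi>
  for G :: "('g, 'c) monoid_scheme" (structure)
    and M :: "'x measure" and \<phi> :: "'g \<Rightarrow> 'x \<Rightarrow> 'x" +
  assumes standard_Borel: "standard_Borel_space M"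
    and Borel_action:
      "(\<lambda>(g, x). \<phi> g x) \<in> count_space (carrier G) \<Otimes>\<^sub>M M \<rightarrow>\<^sub>M M"

definition aperiodic_part ::
    "('g, 'c) monoid_scheme \<Rightarrow> 'x set \<Rightarrow> ('g \<Rightarrow> 'x \<Rightarrow> 'x) \<Rightarrow> 'x set" where
  "aperiodic_part G E \<phi> = {x \<in> E. infinite (orbit G \<phi> x)}"

definition aperiodic ::
    "('g, 'c) monoid_scheme \<Rightarrow> 'x set \<Rightarrow> ('g \<Rightarrow> 'x \<Rightarrow> 'x) \<Rightarrow> bool" where
  "aperiodic G E \<phi> \<longleftrightarrow> (\<forall>x\<in>E. infinite (orbit G \<phi> x))"

text \<open>The space \<open>{0,1}\<^sup>G\<close>, with \<^typ>\<open>bool\<close> in the role of \<open>{0,1}\<close>. Its points are the functions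
  \<^typ>\<open>'g \<Rightarrow> bool\<close> that are \<^term>\<open>undefined\<close> outside the carrier of \<open>G\<close>.\<close>

definition two_power :: "('g, 'c) monoid_scheme \<Rightarrow> ('g \<Rightarrow> bool) topology" where
  "two_power G = product_topology (\<lambda>_. discrete_topology UNIV) (carrier G)"

text \<open>The outer restriction makes each \<open>shift G g\<close> an element of the carrier of
  \<^term>\<open>BijGroup (topspace (two_power G))\<close>, as \<^locale>\<open>group_action\<close> requires.\<close>

definition shift :: "('g, 'c) monoid_scheme \<Rightarrow> 'g \<Rightarrow> ('g \<Rightarrow> bool) \<Rightarrow> ('g \<Rightarrow> bool)" where
  "shift G g =
     (\<lambda>y \<in> topspace (two_power G). \<lambda>h \<in> carrier G. y (inv\<^bsub>G\<^esub> g \<otimes>\<^bsub>G\<^esub> h))"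

lemma topspace_two_power: "topspace (two_power G) = (carrier G \<rightarrow>\<^sub>E UNIV)"
  by (simp add: two_power_def)

lemma (in group) group_action_shift: "group_action G (topspace (two_power G)) (shift G)"
proof -
  let ?E = "topspace (two_power G)"
  have closed: "shift G g y \<in> ?E" if "y \<in> ?E" for g y
    using that by (simp add: shift_def topspace_two_power)
  have mult: "shift G (a \<otimes> b) y = shift G a (shift G b y)"
    if "a \<in> carrier G" "b \<in> carrier G" "y \<in> ?E" for a b y
    using that closed[of y b]
    by (auto simp: shift_def topspace_two_power inv_mult_group m_assoc fun_eq_iff restrict_def)
  have one: "shift G \<one> y = y" if "y \<in> ?E" for y
    using that by (auto simp: shift_def topspace_two_power fun_eq_iff restrict_def PiE_def extensional_def)
  have bij: "shift G g \<in> Bij ?E" if g: "g \<in> carrier G" for g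
  proof -
    have "bij_betw (shift G g) ?E ?E"
    proof (rule bij_betw_byWitness[where f' = "shift G (inv g)"])
      show "\<forall>y\<in>?E. shift G (inv g) (shift G g y) = y"
        using g by (metis inv_closed l_inv mult one)
      show "\<forall>y\<in>?E. shift G g (shift G (inv g) y) = y"
        using g by (metis inv_closed r_inv mult one)
    qed (use closed in auto)
    then show ?thesis by (simp add: Bij_def shift_def)
  qed
  have "shift G (a \<otimes> b) = compose ?E (shift G a) (shift G b)"
    if "a \<in> carrier G" "b \<in> carrier G" for a b
  proof
    fix y show "shift G (a \<otimes> b) y = compose ?E (shift G a) (shift G b) y"
      using that mult by (cases "y \<in> ?E") (auto simp: compose_def shift_def)
  qed
  then have "shift G \<in> hom G (BijGroup ?E)"
    using bij by (auto simp: hom_def BijGroup_def)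
  then show ?thesis
    by (simp add: group_action_def group_hom_def group_hom_axioms_def group_axioms group_BijGroup)
qed

end

theory Submission
  imports Defs "HOL-Library.Fun_Lexorder"
begin

text \<open>An equivariant Borel map to \<open>2\<^sup>G\<close> is given by a Borel set \<open>S\<close>, and we need every orbit to have
  infinitely many \<open>S\<close>-itineraries, where the itinerary of a point records which of its translates
  lie in \<open>S\<close>. Let \<open>B\<^sub>n\<close> be a countable separating family of Borel sets. On an orbit
  where some \<open>B\<^sub>n\<close> has infinitely many itineraries, let \<open>S\<close> be the first such \<open>B\<^sub>n\<close>. On the other orbits
  agreement of the itineraries of \<open>B\<^sub>i\<close> for all \<open>i < n\<close> is an invariant equivalence relation with
  finitely many classes, and these relations separate points in the limit. Choosing the
  lexicographically least itinerary at each stage gives a decreasing sequence of classes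
  \<open>C\<^sub>n\<close>; the nonempty differences \<open>C\<^sub>n - C\<^sub>n\<^sub>+\<^sub>1\<close> are put alternately into \<open>S\<close> and its complement.
  If \<open>S\<close> had only finitely many itineraries on the orbit, all late differences would realise
  the same ones, which is absurd since the itinerary of a point decides membership in \<open>S\<close>.\<close>

section \<open>Lexicographic order and orbits\<close>

text \<open>The first index of disagreement decides. This makes lexicographically minimal
  itineraries unique.\<close>

lemma less_fun_linear:
  fixes u v :: "'a::wellorder \<Rightarrow> 'b::linorder"
  assumes "u \<noteq> v" shows "less_fun u v \<or> less_fun v u"
proof -
  define k where "k = (LEAST k. u k \<noteq> v k)"
  have "\<exists>k. u k \<noteq> v k" using assms by auto
  from LeastI_ex[OF this] have "u k < v k \<or> v k < u k" by (auto simp: k_def)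
  moreover have "u i = v i" if "i < k" for i
    using not_less_Least that unfolding k_def by blast
  ultimately show ?thesis unfolding less_fun_def by auto
qed

lemma (in group_action) orbit_subset:
  assumes "x \<in> E" shows "orbit G \<phi> x \<subseteq> E"
  using assms by (auto simp: orbit_def intro: element_image)

lemma (in group_action) orbit_eq:
  assumes x: "x \<in> E" and y: "y \<in> orbit G \<phi> x"
  shows "orbit G \<phi> y = orbit G \<phi> x"
proof -
  have yE: "y \<in> E" using orbit_subset x y by blast
  have xy: "x \<in> orbit G \<phi> y" using orbit_sym x y yE by blast
  show ?thesis
    using orbit_trans x y yE xy orbit_subset by (meson subsetD subsetI subset_antisym)
qed

lemma (in group_action) act_in_orbit:
  assumes "x \<in> E" "y \<in> orbit G \<phi> x" "g \<in> carrier G"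
  shows "\<phi> g y \<in> orbit G \<phi> x"
proof -
  have "\<phi> g y \<in> orbit G \<phi> y" unfolding orbit_def using assms(3) by blast
  then show ?thesis using orbit_eq assms by simp
qed

lemma (in group_action) orbit_transitive:
  assumes "x \<in> E" "y \<in> orbit G \<phi> x" "z \<in> orbit G \<phi> x"
  obtains g where "g \<in> carrier G" "\<phi> g y = z"
proof -
  have "z \<in> orbit G \<phi> y" using orbit_eq assms by simp
  then show thesis using that by (auto simp: orbit_def)
qed

section \<open>Invariant equivalence relations on an orbit\<close>

text \<open>Invariance of \<open>Q\<close> under \<open>g\<close> and under \<open>inv g\<close>
  makes \<open>\<phi> g\<close> induce a bijection from the fibres of \<open>Q\<close> that meet
  \<open>C\<close> to those that meet its translate.\<close>

lemma (in group_action) card_image_translate: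
  assumes C: "C \<subseteq> E" and g: "g \<in> carrier G"
    and Q: "\<And>g y z. \<lbrakk>g \<in> carrier G; y \<in> E; z \<in> E; Q y = Q z\<rbrakk> \<Longrightarrow> Q (\<phi> g y) = Q (\<phi> g z)"
  shows "card (Q ` \<phi> g ` C) = card (Q ` C)"
proof -
  have inv_g: "inv g \<in> carrier G"
    using g group_hom group_hom.axioms(1) group.inv_closed by metis
  have reflect: "Q (\<phi> g y) = Q (\<phi> g z) \<longleftrightarrow> Q y = Q z" if "y \<in> C" "z \<in> C" for y z
  proof
    assume "Q (\<phi> g y) = Q (\<phi> g z)"
    then have "Q (\<phi> (inv g) (\<phi> g y)) = Q (\<phi> (inv g) (\<phi> g z))"
      using Q inv_g g that C element_image by (meson subsetD)
    then show "Q y = Q z" using orbit_sym_aux g that C by (metis subsetD)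
  qed (use Q g that C in blast)
  \<comment> \<open>The induced map on values of \<open>Q\<close>; by \<open>reflect\<close> it does
    not depend on the chosen representative.\<close>
  define h where "h = (\<lambda>q. Q (\<phi> g (inv_into C Q q)))"
  have h: "h (Q y) = Q (\<phi> g y)" if y: "y \<in> C" for y
    using reflect[OF inv_into_into[of "Q y" Q C] y] f_inv_into_f[of "Q y" Q C] y
    by (simp add: h_def)
  have "Q ` \<phi> g ` C = h ` Q ` C" using h by (simp add: image_image cong: image_cong)
  moreover have "inj_on h (Q ` C)" using h reflect by (auto simp: inj_on_def)
  ultimately show ?thesis by (simp add: card_image)
qed

text \<open>The classes of an invariant equivalence relation on an orbit meet the same number of fibres
  of \<open>Q\<close>. That number is eventually constant along a decreasing sequence of classes, and then the
  classes of the next relation inside \<open>C n\<close> all meet the same fibres.\<close>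

lemma (in group_action) annuli_meet_same_fibres:
  fixes F :: "nat \<Rightarrow> 'c \<Rightarrow> 'v" and Q :: "'c \<Rightarrow> 'w"
  assumes x: "x \<in> E"
    and F: "\<And>i g y z. \<lbrakk>g \<in> carrier G; y \<in> E; z \<in> E; F i y = F i z\<rbrakk> \<Longrightarrow> F i (\<phi> g y) = F i (\<phi> g z)"
    and Q: "\<And>g y z. \<lbrakk>g \<in> carrier G; y \<in> E; z \<in> E; Q y = Q z\<rbrakk> \<Longrightarrow> Q (\<phi> g y) = Q (\<phi> g z)"
    and nonempty: "\<And>n. C n \<noteq> {}" and sub: "\<And>n. C n \<subseteq> orbit G \<phi> x"
    and cls: "\<And>n y. y \<in> C n \<Longrightarrow> C n = {z \<in> orbit G \<phi> x. \<forall>i<n. F i z = F i y}"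
    and dec: "\<And>n. C (Suc n) \<subseteq> C n"
    and fin: "finite (Q ` orbit G \<phi> x)"
  shows "\<exists>n0 W. \<forall>n\<ge>n0. C n \<noteq> C (Suc n) \<longrightarrow> Q ` (C n - C (Suc n)) = W"
proof -
  let ?O = "orbit G \<phi> x"
  have OE: "?O \<subseteq> E" by (rule orbit_subset[OF x])
  have finC: "finite (Q ` C n)" for n using fin sub by (meson finite_subset image_mono)
  have anti: "C n \<subseteq> C m" if "m \<le> n" for m n using lift_Suc_antimono_le[of C] dec that by blast
  obtain n0 where n0: "card (Q ` C n0) \<le> card (Q ` C n)" for n
    using ex_has_least_nat[of "\<lambda>_. True" _ "\<lambda>n. card (Q ` C n)"] by blast
  have eq0: "Q ` C n = Q ` C n0" if "n \<ge> n0" for n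
    using card_subset_eq card_mono anti[OF that] n0[of n] finC
    by (metis image_mono le_antisym)
  show ?thesis
  proof (intro exI allI impI)
    fix n assume n: "n \<ge> n0" and ne: "C n \<noteq> C (Suc n)"
    then obtain y where y: "y \<in> C n" "y \<notin> C (Suc n)" using dec by blast
    obtain c where c: "c \<in> C (Suc n)" using nonempty by blast
    have yO: "y \<in> ?O" and cO: "c \<in> ?O" using y c sub by auto
    then obtain g where g: "g \<in> carrier G" "\<phi> g c = y"
      using orbit_transitive[OF x] by blast
    \<comment> \<open>This translate passes through \<open>y\<close>, so by invariance of the
      \<open>F i\<close> it stays in the class of \<open>y\<close> at stage \<open>Suc n\<close>.
      That class lies in \<open>C n\<close> and misses \<open>C (Suc n)\<close>.\<close>
    let ?D = "\<phi> g ` C (Suc n)"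
    have dO: "d \<in> ?O" if "d \<in> ?D" for d
      using that act_in_orbit[OF x _ g(1)] sub by blast
    have D: "F i d = F i y" if d: "d \<in> ?D" and i: "i < Suc n" for d i
    proof -
      obtain c' where c': "c' \<in> C (Suc n)" "d = \<phi> g c'" using d by blast
      have "F i c' = F i c" using cls[OF c] c' i by auto
      then show ?thesis using F g c c' sub OE by (metis subsetD)
    qed
    have "d \<in> C n" if "d \<in> ?D" for d
      using D[OF that] dO[OF that] cls[OF y(1)] by (simp add: less_Suc_eq)
    moreover have "d \<notin> C (Suc n)" if "d \<in> ?D" for d
    proof
      assume "d \<in> C (Suc n)"
      then have "y \<in> C (Suc n)" using cls[of d "Suc n"] D[OF that] yO by auto
      with y show False by blast
    qed
    ultimately have "?D \<subseteq> C n - C (Suc n)" by blast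
    then have 1: "Q ` ?D \<subseteq> Q ` (C n - C (Suc n))" by blast
    \<comment> \<open>The translate meets as many fibres as \<open>C (Suc n)\<close>, hence as
      \<open>C n0\<close>, so it meets all of them.\<close>
    have "card (Q ` ?D) = card (Q ` C (Suc n))"
      using order_trans[OF sub OE] g(1) by (rule card_image_translate) (rule Q)
    then have "card (Q ` ?D) = card (Q ` C n0)" using eq0[of "Suc n"] n by simp
    moreover have 2: "Q ` (C n - C (Suc n)) \<subseteq> Q ` C n0" using eq0[OF n] by blast
    ultimately have "Q ` ?D = Q ` C n0" using 1 finC by (meson card_subset_eq order_trans)
    with 1 2 show "Q ` (C n - C (Suc n)) = Q ` C n0" by (simp only: subset_antisym)
  qed
qed

section \<open>Itineraries of Borel sets\<close>

text \<open>Enumerating the group by \<open>e\<close> turns quantifiers over an orbit into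
  quantifiers over \<open>nat\<close>, which preserve measurability.\<close>

locale countable_Borel_G_space = Borel_G_space G M \<phi>
  for G :: "('g, 'c) monoid_scheme" (structure)
    and M :: "'x measure" and \<phi> :: "'g \<Rightarrow> 'x \<Rightarrow> 'x" +
  fixes e :: "nat \<Rightarrow> 'g" and B :: "nat \<Rightarrow> 'x set"
  assumes range_e: "range e = carrier G"
    and B_sets: "B n \<in> sets M"
    and B_sep: "\<lbrakk>x \<in> space M; y \<in> space M; x \<noteq> y\<rbrakk> \<Longrightarrow> \<exists>n. (x \<in> B n) \<noteq> (y \<in> B n)"
begin

lemma e_carrier: "e j \<in> carrier G"
  using range_e by blast

lemma group_G: "group G"
  using group_hom group_hom.axioms(1) by blast

lemma act_measurable [measurable]: "\<phi> (e j) \<in> M \<rightarrow>\<^sub>M M"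
proof -
  have "(\<lambda>x. (\<lambda>(g, x). \<phi> g x) (e j, x)) \<in> M \<rightarrow>\<^sub>M M"
    using e_carrier by (intro measurable_compose[OF _ Borel_action]) auto
  then show ?thesis by simp
qed

lemma orbit_range: "orbit G \<phi> x = range (\<lambda>j. \<phi> (e j) x)"
  unfolding orbit_def using range_e by (force simp: image_iff)

text \<open>Indexed by \<open>nat\<close> instead of the group, since the lexicographic comparison
  needs a well-ordered index type.\<close>

definition itin :: "'x set \<Rightarrow> 'x \<Rightarrow> nat \<Rightarrow> bool" where
  "itin S x j \<longleftrightarrow> \<phi> (e j) x \<in> S"

lemma itin_measurable [measurable]:
  assumes "S \<in> sets M" "f \<in> M \<rightarrow>\<^sub>M M" shows "Measurable.pred M (\<lambda>x. itin S (f x) j)"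
  unfolding itin_def using assms by measurable

text \<open>Entry \<open>j\<close> at \<open>\<phi> g x\<close> is the entry at \<open>x\<close> for
  the index of \<open>e j \<otimes> g\<close>, so moving by \<open>g\<close> only reindexes
  itineraries.\<close>

lemma itin_act:
  assumes g: "g \<in> carrier G" and x: "x \<in> space M" and y: "y \<in> space M" and "itin S x = itin S y"
  shows "itin S (\<phi> g x) = itin S (\<phi> g y)"
proof
  fix j
  have "e j \<otimes> g \<in> carrier G"
    using g e_carrier group_G by (simp add: group.is_monoid monoid.m_closed)
  then obtain k where k: "e k = e j \<otimes> g" using range_e by (metis imageE)
  have "itin S (\<phi> g z) j = itin S z k" if "z \<in> space M" for z
    using composition_rule[OF that e_carrier g] k by (simp add: itin_def)
  then show "itin S (\<phi> g x) j = itin S (\<phi> g y) j" using assms by simp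
qed

text \<open>The entry at an index of the identity records membership in \<open>S\<close>.\<close>

lemma itin_eqD:
  assumes "itin S x = itin S y" "x \<in> space M" "y \<in> space M"
  shows "x \<in> S \<longleftrightarrow> y \<in> S"
proof -
  obtain k where "e k = \<one>"
    using range_e group_G by (metis group.is_monoid imageE monoid.one_closed)
  then have "\<phi> (e k) z = z" if "z \<in> space M" for z
    using id_eq_one that by (metis restrict_apply')
  then show ?thesis using assms unfolding itin_def by metis
qed

definition finite_itin :: "'x set \<Rightarrow> 'x \<Rightarrow> bool" where
  "finite_itin S x \<longleftrightarrow> finite (itin S ` orbit G \<phi> x)"

text \<open>Finiteness in terms of number quantifiers only, from which measurability can be read
  off.\<close>

lemma finite_itin_iff:
  "finite_itin S x \<longleftrightarrow> (\<exists>k. \<forall>j. \<exists>i<k. \<forall>l. itin S (\<phi> (e j) x) l = itin S (\<phi> (e i) x) l)"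
    (is "_ \<longleftrightarrow> ?R")
proof
  assume "finite_itin S x"
  then obtain J where J: "finite J" "itin S ` orbit G \<phi> x = (\<lambda>j. itin S (\<phi> (e j) x)) ` J"
    unfolding finite_itin_def orbit_range image_image
    using finite_subset_image[of "range (\<lambda>j. itin S (\<phi> (e j) x))" "\<lambda>j. itin S (\<phi> (e j) x)" UNIV]
    by auto
  obtain k where k: "\<And>i. i \<in> J \<Longrightarrow> i < k" using J(1) finite_nat_iff_bounded by (metis lessThan_iff subsetD)
  have "\<exists>i<k. \<forall>l. itin S (\<phi> (e j) x) l = itin S (\<phi> (e i) x) l" for j
  proof -
    have "itin S (\<phi> (e j) x) \<in> (\<lambda>j. itin S (\<phi> (e j) x)) ` J"
      using J(2) unfolding orbit_range by blast
    then obtain i where "i \<in> J" "itin S (\<phi> (e j) x) = itin S (\<phi> (e i) x)" by blast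
    then show ?thesis using k by metis
  qed
  then show ?R by blast
next
  assume ?R
  then obtain k where k: "\<And>j. \<exists>i<k. itin S (\<phi> (e j) x) = itin S (\<phi> (e i) x)"
    unfolding fun_eq_iff by blast
  have "itin S ` orbit G \<phi> x \<subseteq> (\<lambda>i. itin S (\<phi> (e i) x)) ` {..<k}"
    unfolding orbit_range image_image using k by (auto simp: image_iff)
  then show "finite_itin S x"
    unfolding finite_itin_def by (rule finite_subset) simp
qed

lemma finite_itin_measurable [measurable]:
  assumes [measurable]: "S \<in> sets M"
  shows "Measurable.pred M (finite_itin S)"
  unfolding finite_itin_iff by measurable

lemma finite_itin_orbit:
  assumes "x \<in> space M" "y \<in> orbit G \<phi> x"
  shows "finite_itin S y \<longleftrightarrow> finite_itin S x"
  using orbit_eq[OF assms] by (simp add: finite_itin_def)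

section \<open>Lexicographically least classes\<close>

text \<open>On one orbit this is the class \<open>C\<^sub>n\<close>. Minimality is expressed as the
  absence of a smaller competitor, so the set is defined on all orbits, though it may be empty where
  no least itinerary exists.\<close>

primrec core :: "nat \<Rightarrow> 'x set" where
  "core 0 = space M"
| "core (Suc n) = {x \<in> core n. \<forall>j. \<phi> (e j) x \<in> core n \<longrightarrow>
                     \<not> less_fun (itin (B n) (\<phi> (e j) x)) (itin (B n) x)}"

lemma core_sets [measurable]: "core n \<in> sets M"
proof (induction n)
  case (Suc n)
  note [measurable] = Suc B_sets
  \<comment> \<open>Here \<open>less_fun\<close> is unfolded; for Boolean values, smaller at
    \<open>k\<close> means false against true.\<close>
  have "core (Suc n) = {x \<in> space M. x \<in> core n \<and> (\<forall>j. \<phi> (e j) x \<in> core n \<longrightarrow>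
      \<not> (\<exists>k. (\<not> itin (B n) (\<phi> (e j) x) k \<and> itin (B n) x k) \<and>
          (\<forall>i<k. itin (B n) (\<phi> (e j) x) i = itin (B n) x i)))}"
    using sets.sets_into_space[OF Suc] by (auto simp: less_fun_def less_bool_def)
  also have "\<dots> \<in> sets M" by measurable
  finally show ?case .
qed simp

lemma core_space: "core n \<subseteq> space M"
  using core_sets sets.sets_into_space by blast

definition all_finite :: "'x \<Rightarrow> bool" where
  "all_finite x \<longleftrightarrow> (\<forall>n. finite_itin (B n) x)"

text \<open>A finite nonempty set of itineraries has a minimal element, so each stage passes to a
  nonempty subset.\<close>

lemma core_nonempty:
  assumes x: "x \<in> space M" and fin: "all_finite x"
  shows "core n \<inter> orbit G \<phi> x \<noteq> {}"
proof (induction n)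
  case 0
  show ?case using orbit_refl[OF x] x by auto
next
  case (Suc n)
  let ?V = "itin (B n) ` (core n \<inter> orbit G \<phi> x)"
  have "finite ?V" using fin unfolding all_finite_def finite_itin_def
    by (meson finite_subset image_mono inf_le2)
  moreover have "transp_on ?V (less_fun :: (nat \<Rightarrow> bool) \<Rightarrow> _)"
    by (auto intro!: transp_onI elim: less_fun_trans)
  moreover have "asymp_on ?V (less_fun :: (nat \<Rightarrow> bool) \<Rightarrow> _)"
    by (auto intro!: asymp_onI dest: less_fun_asym)
  ultimately obtain v where v: "v \<in> ?V" "\<forall>w\<in>?V. w \<noteq> v \<longrightarrow> \<not> less_fun w v"
    using Finite_Set.bex_min_element[of ?V less_fun] Suc by blast
  then obtain y where y: "y \<in> core n" "y \<in> orbit G \<phi> x" "v = itin (B n) y" by blast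
  have "\<phi> (e j) y \<in> orbit G \<phi> x" for j
    using orbit_eq[OF x y(2)] orbit_range by blast
  then have "\<not> less_fun (itin (B n) (\<phi> (e j) y)) (itin (B n) y)" if "\<phi> (e j) y \<in> core n" for j
    using v y that less_fun_irrefl by (metis IntI imageI)
  then have "y \<in> core (Suc n)" using y by simp
  then show ?case using y by blast
qed

text \<open>Totality of the order leaves one minimal itinerary per stage, and every point of the
  previous stage that realises it is kept.\<close>

lemma core_class:
  assumes x: "x \<in> space M" and y: "y \<in> core n" "y \<in> orbit G \<phi> x"
  shows "core n \<inter> orbit G \<phi> x = {z \<in> orbit G \<phi> x. \<forall>i<n. itin (B i) z = itin (B i) y}"
  using y
proof (induction n)
  case 0
  then show ?case using orbit_subset[OF x] by auto
next
  case (Suc n)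
  then have IH: "core n \<inter> orbit G \<phi> x = {z \<in> orbit G \<phi> x. \<forall>i<n. itin (B i) z = itin (B i) y}"
    by simp
  have min: "\<not> less_fun (itin (B n) w) (itin (B n) z)"
    if z: "z \<in> core (Suc n)" "z \<in> orbit G \<phi> x" and w: "w \<in> core n" "w \<in> orbit G \<phi> x" for z w
  proof -
    obtain j where "w = \<phi> (e j) z" using w(2) orbit_eq[OF x z(2)] orbit_range[of z] by auto
    then show ?thesis using z w by auto
  qed
  have "itin (B n) z = itin (B n) y" if "z \<in> core (Suc n)" "z \<in> orbit G \<phi> x" for z
    using min[of z y] min[of y z] that Suc.prems less_fun_linear by auto
  moreover have "z \<in> core (Suc n)"
    if z: "z \<in> core n" "z \<in> orbit G \<phi> x" "itin (B n) z = itin (B n) y" for z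
  proof -
    have "\<phi> (e j) z \<in> orbit G \<phi> x" for j using act_in_orbit[OF x z(2) e_carrier] .
    then show ?thesis using z min[OF Suc.prems] by simp
  qed
  ultimately have "core (Suc n) \<inter> orbit G \<phi> x =
      {z \<in> core n \<inter> orbit G \<phi> x. itin (B n) z = itin (B n) y}"
    by auto
  then show ?case unfolding IH by (auto simp: less_Suc_eq)
qed

lemma core_Suc_subset: "core (Suc n) \<subseteq> core n"
  by auto

declare core.simps(2) [simp del]

section \<open>Alternating annuli\<close>

definition drops :: "nat \<Rightarrow> 'x \<Rightarrow> bool" where
  "drops n x \<longleftrightarrow> (\<exists>j. \<phi> (e j) x \<in> core n - core (Suc n))"

lemma drops_iff:
  assumes "x \<in> space M"
  shows "drops n x \<longleftrightarrow> core n \<inter> orbit G \<phi> x \<noteq> core (Suc n) \<inter> orbit G \<phi> x"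
  unfolding drops_def orbit_range using core_Suc_subset[of n] by blast

lemma drops_measurable [measurable]: "Measurable.pred M (drops n)"
  unfolding drops_def by measurable

text \<open>The parity of the number of \<open>m < n\<close> with \<open>drops m x\<close>. Counting
  drops instead of stages makes consecutive nonempty differences alternate even when idle stages lie
  between them.\<close>

primrec even_drops :: "nat \<Rightarrow> 'x \<Rightarrow> bool" where
  "even_drops 0 x = True"
| "even_drops (Suc n) x = (even_drops n x \<noteq> drops n x)"

lemma even_drops_measurable [measurable]: "Measurable.pred M (even_drops n)"
proof (induction n)
  case (Suc n)
  note [measurable] = Suc
  show ?case unfolding even_drops.simps by measurable
qed simp

lemma even_drops_orbit:
  assumes x: "x \<in> space M" and y: "y \<in> orbit G \<phi> x"
  shows "even_drops n y \<longleftrightarrow> even_drops n x"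
proof (induction n)
  case (Suc n)
  have "y \<in> space M" using x y orbit_subset by blast
  then have "drops n y = drops n x" using drops_iff x orbit_eq[OF x y] by simp
  with Suc show ?case by simp
qed simp

definition annuli :: "'x set" where
  "annuli = {x \<in> space M. \<exists>n. x \<in> core n - core (Suc n) \<and> even_drops n x}"

lemma annuli_sets [measurable]: "annuli \<in> sets M"
  unfolding annuli_def by measurable

lemma core_antimono: "m \<le> n \<Longrightarrow> core n \<subseteq> core m"
  by (rule lift_Suc_antimono_le[of core]) (rule core_Suc_subset)

text \<open>The differences of a decreasing sequence are disjoint, so \<open>x\<close> determines
  \<open>n\<close>.\<close>

lemma annuli_iff:
  assumes "x \<in> core n - core (Suc n)"
  shows "x \<in> annuli \<longleftrightarrow> even_drops n x"
proof -
  have "m = n" if "x \<in> core m - core (Suc m)" for m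
    using that assms core_antimono[of "Suc m" n] core_antimono[of "Suc n" m]
    by (metis DiffE not_less_eq_eq le_antisym subsetD)
  then show ?thesis unfolding annuli_def using assms core_space by blast
qed

text \<open>If nothing drops from \<open>N\<close> on, the class at stage \<open>N\<close> agrees on
  all \<open>B n\<close> and is a single point. By invariance all classes of that stage are single
  points, yet there are only finitely many of them.\<close>

lemma infinitely_many_drops:
  assumes x: "x \<in> space M" and fin: "all_finite x" and inf: "infinite (orbit G \<phi> x)"
  shows "\<exists>n\<ge>N. drops n x"
proof (rule ccontr)
  assume no: "\<not> ?thesis"
  have const: "core n \<inter> orbit G \<phi> x = core N \<inter> orbit G \<phi> x" if "n \<ge> N" for n
    using that
  proof (induction n rule: dec_induct)
    case (step n)
    have "\<not> drops n x" using no step(1) by blast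
    then show ?case using drops_iff[OF x] step.IH by blast
  qed simp
  obtain y where y: "y \<in> core N" "y \<in> orbit G \<phi> x" using core_nonempty[OF x fin] by blast
  have yS: "y \<in> space M" using y core_space by blast
  have single: "z = y" if z: "z \<in> orbit G \<phi> x" "\<forall>i<N. itin (B i) z = itin (B i) y" for z
  proof (rule ccontr)
    assume "z \<noteq> y"
    have zS: "z \<in> space M" using z x orbit_subset by blast
    have zN: "z \<in> core N" using core_class[OF x y] z by blast
    obtain n where n: "(z \<in> B n) \<noteq> (y \<in> B n)" using B_sep zS yS \<open>z \<noteq> y\<close> by blast
    \<comment> \<open>Late enough for \<open>core k\<close> to equal \<open>core N\<close> on the
      orbit and for its class to take \<open>B n\<close> into account.\<close>
    define k where "k = max N (Suc n)"
    have k: "k \<ge> N" "n < k" by (auto simp: k_def)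
    have yk: "y \<in> core k" and "z \<in> core k"
      using const[OF k(1)] y zN z by auto
    then have "itin (B n) z = itin (B n) y"
      using core_class[OF x yk y(2)] z k(2) by blast
    then show False using n itin_eqD zS yS by blast
  qed
  \<comment> \<open>\<open>K\<close> codes the class at stage \<open>N\<close>; restricting it
    places the codes in a finite product.\<close>
  define K where "K = (\<lambda>z. restrict (\<lambda>i. itin (B i) z) {..<N})"
  have "inj_on K (orbit G \<phi> x)"
  proof (rule inj_onI)
    fix z w assume z: "z \<in> orbit G \<phi> x" and w: "w \<in> orbit G \<phi> x" and "K z = K w"
    then have eq: "itin (B i) z = itin (B i) w" if "i < N" for i
      using that unfolding K_def by (metis lessThan_iff restrict_apply')
    have zS: "z \<in> space M" and wS: "w \<in> space M" using z w x orbit_subset by auto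
    \<comment> \<open>Only the class of \<open>y\<close> is known to be a point, so \<open>z\<close>
      is moved to \<open>y\<close>.\<close>
    obtain g where g: "g \<in> carrier G" "\<phi> g z = y"
      using orbit_transitive[OF x z y(2)] by blast
    have "\<phi> g w \<in> orbit G \<phi> x" using act_in_orbit[OF x w] g by blast
    moreover have "itin (B i) (\<phi> g w) = itin (B i) y" if "i < N" for i
      using itin_act[OF g(1) zS wS] eq[OF that] g by metis
    ultimately have "\<phi> g w = y" using single by blast
    then show "z = w" using g inj_prop zS wS by (metis inj_onD)
  qed
  moreover have "K ` orbit G \<phi> x \<subseteq> (\<Pi>\<^sub>E i\<in>{..<N}. itin (B i) ` orbit G \<phi> x)"
    unfolding K_def by auto
  moreover have "finite (\<Pi>\<^sub>E i\<in>{..<N}. itin (B i) ` orbit G \<phi> x)"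
    using fin by (intro finite_PiE) (auto simp: all_finite_def finite_itin_def)
  ultimately show False using inf by (meson finite_imageD finite_subset)
qed

text \<open>With finitely many itineraries, two consecutive late differences would realise the same
  ones, although one lies inside \<open>annuli\<close> and the other outside.\<close>

lemma annuli_infinite_itin:
  assumes x: "x \<in> space M" and fin: "all_finite x" and inf: "infinite (orbit G \<phi> x)"
  shows "\<not> finite_itin annuli x"
proof
  assume fin_annuli: "finite_itin annuli x"
  define V where
    "V = (\<lambda>n. itin annuli ` (core n \<inter> orbit G \<phi> x - core (Suc n) \<inter> orbit G \<phi> x))"
  have "\<exists>n0 W. \<forall>n\<ge>n0. drops n x \<longrightarrow> V n = W"
    unfolding drops_iff[OF x] V_def
  proof (rule annuli_meet_same_fibres[OF x, where F = "\<lambda>i. itin (B i)"])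
    show "core n \<inter> orbit G \<phi> x \<noteq> {}" for n by (rule core_nonempty[OF x fin])
    show "core n \<inter> orbit G \<phi> x = {z \<in> orbit G \<phi> x. \<forall>i<n. itin (B i) z = itin (B i) y}"
      if "y \<in> core n \<inter> orbit G \<phi> x" for n y
      using that core_class[OF x] by blast
    show "finite (itin annuli ` orbit G \<phi> x)"
      using fin_annuli by (simp add: finite_itin_def)
  qed (use core_Suc_subset in \<open>auto intro: itin_act\<close>)
  then obtain n0 W where W: "\<And>n. \<lbrakk>n \<ge> n0; drops n x\<rbrakk> \<Longrightarrow> V n = W"
    by metis
  obtain n where n: "n \<ge> n0" "drops n x"
    using infinitely_many_drops[OF assms] by blast
  \<comment> \<open>The next drop after \<open>n\<close>: the parity flips once, at
    \<open>n\<close>, between the two stages.\<close>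
  define m where "m = (LEAST m. m \<ge> Suc n \<and> drops m x)"
  have m: "m \<ge> Suc n" "drops m x"
    unfolding m_def using LeastI_ex[OF infinitely_many_drops[OF assms, of "Suc n"]] by auto
  have none: "\<not> drops k x" if "Suc n \<le> k" "k < m" for k
    using that not_less_Least unfolding m_def by blast
  have "even_drops k x = even_drops (Suc n) x" if "Suc n \<le> k" "k \<le> m" for k
    using that
  proof (induction k rule: dec_induct)
    case (step k)
    then show ?case using none[of k] by simp
  qed simp
  then have parity: "even_drops m x \<noteq> even_drops n x" using m n by auto
  obtain y where y: "y \<in> core n - core (Suc n)" "y \<in> orbit G \<phi> x"
    using n drops_iff[OF x] core_antimono[of n "Suc n"] by auto
  have "itin annuli y \<in> V n" unfolding V_def using y by blast
  also have "V n = V m" using W[OF n] W[of m] m n by simp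
  finally obtain z where z: "z \<in> core m - core (Suc m)" "z \<in> orbit G \<phi> x"
      "itin annuli y = itin annuli z"
    unfolding V_def by blast
  have "y \<in> annuli \<longleftrightarrow> z \<in> annuli"
    using itin_eqD[OF z(3)] y z core_space by blast
  then show False
    using annuli_iff y z even_drops_orbit[OF x] parity by metis
qed

section \<open>The Borel marker set\<close>

definition first_infinite :: "nat \<Rightarrow> 'x \<Rightarrow> bool" where
  "first_infinite n x \<longleftrightarrow> \<not> finite_itin (B n) x \<and> (\<forall>m<n. finite_itin (B m) x)"

text \<open>The set \<open>S\<close>. The case conditions are constant on orbits, so on each orbit
  it is a single \<open>B n\<close> or \<open>annuli\<close>.\<close>

definition marker :: "'x set" where
  "marker = {x \<in> space M. (\<exists>n. first_infinite n x \<and> x \<in> B n) \<or> (all_finite x \<and> x \<in> annuli)}"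

lemma marker_sets: "marker \<in> sets M"
proof -
  note [measurable] = B_sets
  show ?thesis unfolding marker_def first_infinite_def all_finite_def by measurable
qed

text \<open>Itineraries see only the trace of \<open>S\<close> on the orbit, which lets
  \<open>marker\<close> be replaced orbit by orbit.\<close>

lemma finite_itin_cong:
  assumes x: "x \<in> space M" and eq: "S \<inter> orbit G \<phi> x = S' \<inter> orbit G \<phi> x"
  shows "finite_itin S x \<longleftrightarrow> finite_itin S' x"
proof -
  have "itin S y = itin S' y" if "y \<in> orbit G \<phi> x" for y
    using orbit_eq[OF x that] eq orbit_range[of y] by (auto simp: itin_def fun_eq_iff)
  then show ?thesis unfolding finite_itin_def by (metis image_cong)
qed

lemma marker_infinite_itin:
  assumes x: "x \<in> space M" and inf: "infinite (orbit G \<phi> x)"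
  shows "\<not> finite_itin marker x"
proof (cases "all_finite x")
  case True
  have "marker \<inter> orbit G \<phi> x = annuli \<inter> orbit G \<phi> x"
    using True finite_itin_orbit[OF x] orbit_subset[OF x]
    by (auto simp: marker_def first_infinite_def all_finite_def)
  then show ?thesis
    using annuli_infinite_itin[OF x True inf] finite_itin_cong[OF x] by blast
next
  case False
  define n where "n = (LEAST n. \<not> finite_itin (B n) x)"
  have n: "\<not> finite_itin (B n) x"
    using LeastI_ex[of "\<lambda>n. \<not> finite_itin (B n) x"] False by (simp add: n_def all_finite_def)
  have less: "finite_itin (B m) x" if "m < n" for m
    using not_less_Least that unfolding n_def by blast
  have "first_infinite m y \<longleftrightarrow> m = n" if "y \<in> orbit G \<phi> x" for m y
    unfolding first_infinite_def finite_itin_orbit[OF x that]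
    using n less by (metis linorder_neqE_nat)
  then have "marker \<inter> orbit G \<phi> x = B n \<inter> orbit G \<phi> x"
    using False finite_itin_orbit[OF x] orbit_subset[OF x]
    by (auto simp: marker_def all_finite_def)
  then show ?thesis
    using n finite_itin_cong[OF x] by blast
qed

end

section \<open>Measurability into \<open>2^G\<close> and separating families\<close>

text \<open>Since the group is countable, there are countably many cylinders, and every open set is
  a union of them.\<close>

lemma measurable_two_power:
  assumes G: "countable (carrier G)"
    and f: "\<And>x. x \<in> space M \<Longrightarrow> f x \<in> topspace (two_power G)"
    and coord: "\<And>h. h \<in> carrier G \<Longrightarrow> Measurable.pred M (\<lambda>x. f x h)"
  shows "f \<in> M \<rightarrow>\<^sub>M borel_of (two_power G)"
  unfolding borel_of_def
proof (rule measurable_measure_of)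
  show "{U. openin (two_power G) U} \<subseteq> Pow (topspace (two_power G))"
    using openin_subset by blast
  show "f \<in> space M \<rightarrow> topspace (two_power G)" using f by blast
  fix U assume "U \<in> {U. openin (two_power G) U}"
  then have U: "openin (two_power G) U" by simp
  \<comment> \<open>\<open>F\<close> holds the constrained coordinates and \<open>S\<close> tells
    where the value is true, so cylinders are coded by pairs of finite sets.\<close>
  define cyl where "cyl = (\<lambda>(F, S). {y \<in> topspace (two_power G). \<forall>h\<in>F. y h = (h \<in> S)})"
  define \<I> where "\<I> = {F. finite F \<and> F \<subseteq> carrier G} \<times> {F. finite F \<and> F \<subseteq> carrier G}"
  have count: "countable \<I>"
    unfolding \<I>_def using G by (intro countable_SIGMA countable_Collect_finite_subset)
  have cyl_sets: "f -` cyl I \<inter> space M \<in> sets M" if I: "I \<in> \<I>" for I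
  proof -
    obtain F S where FS: "I = (F, S)" by fastforce
    have F: "finite F" "F \<subseteq> carrier G" using I FS by (auto simp: \<I>_def)
    have "f -` cyl I \<inter> space M = {x \<in> space M. \<forall>h\<in>F. f x h = (h \<in> S)}"
      using f FS by (auto simp: cyl_def)
    also have "\<dots> \<in> sets M"
    proof (rule sets.sets_Collect_finite_All[OF _ F(1)])
      fix h assume "h \<in> F"
      then have [measurable]: "Measurable.pred M (\<lambda>x. f x h)" using coord F by blast
      show "{x \<in> space M. f x h = (h \<in> S)} \<in> sets M" by measurable
    qed
    finally show ?thesis .
  qed
  have "\<exists>I\<in>\<I>. y \<in> cyl I \<and> cyl I \<subseteq> U" if y: "y \<in> U" for y
  proof -
    obtain V where V: "finite {i \<in> carrier G. V i \<noteq> UNIV}" "y \<in> Pi\<^sub>E (carrier G) V"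
        "Pi\<^sub>E (carrier G) V \<subseteq> U"
      using U y unfolding two_power_def openin_product_topology_alt by auto
    define F where "F = {i \<in> carrier G. V i \<noteq> UNIV}"
    have "z \<in> Pi\<^sub>E (carrier G) V" if z: "z \<in> cyl (F, {i \<in> F. y i})" for z
    proof (rule PiE_I)
      fix i assume i: "i \<in> carrier G"
      show "z i \<in> V i"
      proof (cases "i \<in> F")
        case True
        then have "z i = y i" using z by (simp add: cyl_def)
        then show ?thesis using V(2) i by auto
      qed (use i F_def in auto)
    next
      fix i assume "i \<notin> carrier G"
      then show "z i = undefined"
        using z by (auto simp: cyl_def topspace_two_power PiE_def extensional_def)
    qed
    moreover have "y \<in> cyl (F, {i \<in> F. y i})"
      using openin_subset[OF U] y by (auto simp: cyl_def)
    moreover have "(F, {i \<in> F. y i}) \<in> \<I>"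
      using V(1) finite_subset[of "{i \<in> F. y i}" F] by (auto simp: \<I>_def F_def)
    ultimately show ?thesis using V(3) by blast
  qed
  then have "f -` U \<inter> space M = (\<Union>I\<in>{I \<in> \<I>. cyl I \<subseteq> U}. f -` cyl I \<inter> space M)"
    by blast
  also have "\<dots> \<in> sets M"
  proof (rule sets.countable_UN')
    show "countable {I \<in> \<I>. cyl I \<subseteq> U}" using count by (rule countable_subset[rotated]) blast
  qed (use cyl_sets in auto)
  finally show "f -` U \<inter> space M \<in> sets M" .
qed

text \<open>A countable base of a Hausdorff topology separates points.\<close>

lemma standard_Borel_space_separating:
  assumes "standard_Borel_space M"
  obtains B :: "nat \<Rightarrow> 'a set" where "\<And>n. B n \<in> sets M"
    and "\<And>x y. \<lbrakk>x \<in> space M; y \<in> space M; x \<noteq> y\<rbrakk> \<Longrightarrow> \<exists>n. (x \<in> B n) \<noteq> (y \<in> B n)"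
proof -
  obtain T where T: "completely_metrizable_space T" "second_countable T" "space M = topspace T"
      "sets M = sets (borel_of T)"
    using assms by (auto simp: standard_Borel_space_def Polish_space_def)
  obtain \<B> where \<B>: "countable \<B>" "\<forall>V\<in>\<B>. openin T V"
      "\<forall>U x. openin T U \<and> x \<in> U \<longrightarrow> (\<exists>V\<in>\<B>. x \<in> V \<and> V \<subseteq> U)"
    using T(2) unfolding second_countable_def by (elim exE conjE) (rule that)
  have haus: "Hausdorff_space T"
    using T(1) completely_metrizable_imp_metrizable_space metrizable_imp_Hausdorff_space by blast
  have open_sets: "V \<in> sets M" if "openin T V" for V
  proof -
    have "{U. openin T U} \<subseteq> Pow (topspace T)" using openin_subset by blast
    then show ?thesis using that by (simp add: T(4) borel_of_def sigma_sets.Basic)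
  qed
  \<comment> \<open>The empty set is added because only a nonempty countable set is the range of its
    enumeration.\<close>
  let ?B = "from_nat_into (insert {} \<B>)"
  have range: "range ?B = insert {} \<B>"
    using \<B>(1) by (intro range_from_nat_into) auto
  show thesis
  proof
    show "?B n \<in> sets M" for n
      using range open_sets \<B>(2) by (metis insertE openin_empty rangeI)
    fix x y assume "x \<in> space M" "y \<in> space M" "x \<noteq> y"
    then obtain U where "openin T U" "x \<in> U" "y \<notin> U"
      using haus T(3) unfolding Hausdorff_space_def disjnt_iff by metis
    then obtain V where "V \<in> \<B>" "x \<in> V" "y \<notin> V" using \<B>(3) by (meson subsetD)
    moreover obtain n where "?B n = V" using range \<open>V \<in> \<B>\<close> by (metis imageE insertI2)
    ultimately show "\<exists>n. (x \<in> ?B n) \<noteq> (y \<in> ?B n)" by blast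
  qed
qed

section \<open>The equivariant map\<close>

theorem theorem8p8:
  fixes G :: "('g, 'c) monoid_scheme"
    and M :: "'x measure"
    and \<phi> :: "'g \<Rightarrow> 'x \<Rightarrow> 'x"
  assumes "group G" and "countable (carrier G)" and "infinite (carrier G)"
    and "Borel_G_space G M \<phi>"
    and "aperiodic G (space M) \<phi>"
  shows "\<exists>f. f \<in> M \<rightarrow>\<^sub>M borel_of (two_power G) \<and>
             (\<forall>g\<in>carrier G. \<forall>x\<in>space M. f (\<phi> g x) = shift G g (f x)) \<and>
             f ` space M \<subseteq> aperiodic_part G (topspace (two_power G)) (shift G)"
proof -
  interpret group G by fact
  interpret Borel_G_space G M \<phi> by fact
  obtain B :: "nat \<Rightarrow> 'x set" where B: "\<And>n. B n \<in> sets M"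
    "\<And>x y. \<lbrakk>x \<in> space M; y \<in> space M; x \<noteq> y\<rbrakk> \<Longrightarrow> \<exists>n. (x \<in> B n) \<noteq> (y \<in> B n)"
    using standard_Borel_space_separating[OF standard_Borel] by blast
  define e where "e = from_nat_into (carrier G)"
  have e: "range e = carrier G"
    unfolding e_def using assms(2) by (intro range_from_nat_into) auto
  interpret countable_Borel_G_space G M \<phi> e B
    by unfold_locales (use e B in auto)
  \<comment> \<open>The inverse matches the one in the shift: both sides of equivariance at
    \<open>h\<close> test whether \<open>inv h \<otimes> g\<close> moves \<open>x\<close> into
    \<open>marker\<close>.\<close>
  define f where "f = (\<lambda>x. \<lambda>h\<in>carrier G. \<phi> (inv\<^bsub>G\<^esub> h) x \<in> marker)"
  have f_top: "f x \<in> topspace (two_power G)" for x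
    by (simp add: f_def topspace_two_power)
  have meas: "f \<in> M \<rightarrow>\<^sub>M borel_of (two_power G)"
  proof (rule measurable_two_power[OF assms(2) f_top])
    fix h assume h: "h \<in> carrier G"
    then obtain j where "e j = inv\<^bsub>G\<^esub> h" using e by (metis imageE inv_closed)
    then have "(\<lambda>x. f x h) = (\<lambda>x. \<phi> (e j) x \<in> marker)" using h by (simp add: f_def)
    moreover have "Measurable.pred M (\<lambda>x. \<phi> (e j) x \<in> marker)" using marker_sets by measurable
    ultimately show "Measurable.pred M (\<lambda>x. f x h)" by simp
  qed
  have equi: "f (\<phi> g x) = shift G g (f x)" if g: "g \<in> carrier G" and x: "x \<in> space M" for g x
  proof
    fix h
    show "f (\<phi> g x) h = shift G g (f x) h"
    proof (cases "h \<in> carrier G")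
      case True
      then have "\<phi> (inv\<^bsub>G\<^esub> h) (\<phi> g x) = \<phi> (inv\<^bsub>G\<^esub> (inv\<^bsub>G\<^esub> g \<otimes>\<^bsub>G\<^esub> h)) x"
        using g x by (simp add: inv_mult_group composition_rule)
      then show ?thesis using True g f_top[of x] by (simp add: shift_def f_def)
    qed (simp add: shift_def f_def f_top[unfolded f_def])
  qed
  have "infinite (orbit G (shift G) (f x))" if x: "x \<in> space M" for x
  proof
    assume fin: "finite (orbit G (shift G) (f x))"
    \<comment> \<open>Itineraries are the values of \<open>f\<close> with coordinates reindexed, so
      a finite orbit of \<open>f x\<close> would leave finitely many itineraries of
      \<open>marker\<close>.\<close>
    have "orbit G (shift G) (f x) = f ` orbit G \<phi> x"
      unfolding orbit_def using equi x by (auto simp: image_iff) metis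
    moreover have "itin marker y = (\<lambda>j. f y (inv\<^bsub>G\<^esub> (e j)))" for y
      using e_carrier by (auto simp: itin_def f_def)
    then have "itin marker ` orbit G \<phi> x = (\<lambda>z j. z (inv\<^bsub>G\<^esub> (e j))) ` f ` orbit G \<phi> x"
      by (simp add: image_image)
    ultimately have "finite_itin marker x" using fin by (simp add: finite_itin_def)
    then show False
      using marker_infinite_itin x assms(5) by (auto simp: aperiodic_def)
  qed
  then show ?thesis
    using meas equi f_top by (intro exI[of _ f]) (auto simp: aperiodic_part_def)
qed

end
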